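(* Suppose that there exist scalars $C_1, C_2, C_3 \ge 0$, independent of $N$, such that, for the Hölder-conjugate exponent pairs $(p_1,p_1')$, $(p_2,p_2')$ and $(p_3,p_3')$, we have for all $N\in\mathbb{N}$: (a) $\min\left\{ \left\| \mathbb{E}_{\nu_N}[\exp(-\Phi_N)]^{-1} \right\|_{L^{p_1}_{\mu_0}(\mathcal{U})},\ \left\| \exp(\Phi) \right\|_{L^{p_1}_{\mu_0}(\mathcal{U})} \right\} \le C_1 = C_1(p_1)$; (b) $\left\| \mathbb{E}_{\nu_N}\left[ \left( \exp(-\Phi)+\exp(-\Phi_N) \right)^{p_2} \right]^{1/p_2} \right\|_{L^{2p_1'p_3}_{\mu_0}(\mathcal{U})} \le C_2 = C_2(p_1,p_2,p_3)$; (c) $C_3^{-1} \le \mathbb{E}_{\nu_N}[Z_N^{\mathrm{S}}] \le C_3$. Then there exists $C = C(C_1,C_2,C_3,Z) > 0$, independent of $N$, such that for all $N$ $$ d_{\mathrm{H}}(\mu,\mu_N^{\mathrm{M}}) \le C \left\| \mathbb{E}_{\nu_N}\left[ |\Phi-\Phi_N|^{p_2'} \right]^{1/p_2'} \right\|_{L^{2p_1'p_3'}_{\mu_0}(\mathcal{U})}, $$ with $$ C(C_1,C_2,C_3,Z) = \left( \frac{C_1(p_1)}{Z} + C_3 \max\{Z^{-3}, C_3^{3}\} \right) C_2^2(p_1,p_2,p_3). $$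
   Context: $\mathcal{U}$ is a separable Banach space with its Borel $\sigma$-algebra, $\mu_0$ is a probability measure (prior) on $\mathcal{U}$, and $\Phi:\mathcal{U}\to\mathbb{R}$ is a measurable function (negative log-likelihood; the data are fixed) with $Z := \mathbb{E}_{\mu_0}[\exp(-\Phi)] \in (0,\infty)$. The exact posterior $\mu$ is the probability measure with $\frac{d\mu}{d\mu_0}(u) = \exp(-\Phi(u))/Z$. For each $N\in\mathbb{N}$, $\Phi_N:\Omega\times\mathcal{U}\to\mathbb{R}$ is a measurable function (random approximation of $\Phi$) and $\nu_N$ is a probability measure on $\Omega$; the arguments $(\omega,u)$ of $\Phi_N$ are distributed as $\nu_N\otimes\mu_0$, i.e. the randomness of $\Phi_N$ is independent of $u$. $\mathbb{E}_{\nu_N}[\cdot]$ denotes integration over $\omega$ only, so that e.g. $\mathbb{E}_{\nu_N}[\exp(-\Phi_N)]$ is a function of $u\in\mathcal{U}$; $\mathbb{E}_{\nu_N}[\exp(-\Phi_N)]^{-1}$ is its reciprocal. Define $$Z_N^{\mathrm{S}}(\omega) := \mathbb{E}_{\mu_0}[\exp(-\Phi_N(\omega,\cdot))], \qquad \frac{d\mu_N^{\mathrm{M}}}{d\mu_0}(u) := \frac{\mathbb{E}_{\nu_N}[\exp(-\Phi_N(u))]}{\mathbb{E}_{\nu_N}[Z_N^{\mathrm{S}}]}$$ ($\mu_N^{\mathrm{M}}$ is the marginal approximate posterior). The Hellinger distance of probability measures $\mu,\nu$ absolutely continuous with respect to a reference measure $\pi$ is $d_{\mathrm{H}}(\mu,\nu)^2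 := \frac12\int_{\mathcal{U}} \left| \sqrt{d\mu/d\pi}-\sqrt{d\nu/d\pi}\right|^2 d\pi$. Hölder-conjugate exponents lie in $[1,\infty]$ with $1/p+1/p'=1$; for an infinite exponent, $\mathbb{E}_{\nu_N}[|X|^p]^{1/p}$ is read as the $\nu_N$-essential supremum of $|X|$. *)

theory Defs
  imports "HOL-Probability.Probability"
begin

text \<open>Norms are taken in \<^typ>\<open>ennreal\<close> so that infinite norms are represented faithfully;
  exponents range over the extended half-line \<open>[1, \<infinity>]\<close>, also inside \<^typ>\<open>ennreal\<close>.\<close>

definition conjugate_exponents :: "ennreal \<Rightarrow> ennreal \<Rightarrow> bool" where
  "conjugate_exponents p p' \<longleftrightarrow> 1 \<le> p \<and> 1 \<le> p' \<and> inverse p + inverse p' = 1"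

text \<open>Power of an extended nonnegative number; only used for exponents \<open>r > 0\<close>.\<close>

definition ennreal_pow :: "ennreal \<Rightarrow> real \<Rightarrow> ennreal" where
  "ennreal_pow x r = (if x = \<infinity> then \<infinity> else ennreal (enn2real x powr r))"

text \<open>\<open>Lp_norm M p f\<close> is the \<open>L\<^sup>p(M)\<close> norm of a nonnegative, possibly infinite, function
  for \<open>p \<in> [1, \<infinity>]\<close>. It is also used for \<open>E[f\<^sup>p]\<^sup>1\<^sup>/\<^sup>p\<close>, which is
  the essential supremum when \<open>p = \<infinity>\<close>.\<close>

definition Lp_norm :: "'a measure \<Rightarrow> ennreal \<Rightarrow> ('a \<Rightarrow> ennreal) \<Rightarrow> ennreal" where
  "Lp_norm M p f =
     (if p = \<infinity> then esssup M f
      else ennreal_pow (\<integral>\<^sup>+x. ennreal_pow (f x) (enn2real p) \<partial>M) (1 / enn2real p))"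

text \<open>\<open>hellinger \<pi> \<mu> \<nu>\<close> is meant for probability measures \<open>\<mu>, \<nu>\<close> that are
  absolutely continuous with respect to \<open>\<pi>\<close>; the integrand is then always integrable.\<close>

definition hellinger :: "'a measure \<Rightarrow> 'a measure \<Rightarrow> 'a measure \<Rightarrow> real" where
  "hellinger \<pi> \<mu> \<nu> =
     sqrt (1 / 2 * (\<integral>u. \<bar>sqrt (enn2real (RN_deriv \<pi> \<mu> u)) - sqrt (enn2real (RN_deriv \<pi> \<nu> u))\<bar>\<^sup>2 \<partial>\<pi>))"

text \<open>\<open>evidence \<mu>0 \<Phi>\<close> is the normalising constant \<open>Z\<close>, and
  \<open>evidence \<mu>0 (\<Phi>N \<omega>)\<close> is the random normalising constant \<open>Z\<^sub>N\<^sup>S(\<omega>)\<close>.\<close>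

definition evidence :: "'u measure \<Rightarrow> ('u \<Rightarrow> real) \<Rightarrow> ennreal" where
  "evidence \<mu>0 \<Phi> = (\<integral>\<^sup>+u. ennreal (exp (- \<Phi> u)) \<partial>\<mu>0)"

definition posterior :: "'u measure \<Rightarrow> ('u \<Rightarrow> real) \<Rightarrow> 'u measure" where
  "posterior \<mu>0 \<Phi> = density \<mu>0 (\<lambda>u. ennreal (exp (- \<Phi> u)) / evidence \<mu>0 \<Phi>)"

text \<open>The function \<open>u \<mapsto> E\<^sub>\<nu>[exp(-\<Phi>N(\<cdot>, u))]\<close>.\<close>

definition mean_likelihood :: "'w measure \<Rightarrow> ('w \<Rightarrow> 'u \<Rightarrow> real) \<Rightarrow> 'u \<Rightarrow> ennreal" where
  "mean_likelihood \<nu> \<Phi>N u = (\<integral>\<^sup>+\<omega>. ennreal (exp (- \<Phi>N \<omega> u)) \<partial>\<nu>)"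

definition mean_evidence :: "'u measure \<Rightarrow> 'w measure \<Rightarrow> ('w \<Rightarrow> 'u \<Rightarrow> real) \<Rightarrow> ennreal" where
  "mean_evidence \<mu>0 \<nu> \<Phi>N = (\<integral>\<^sup>+\<omega>. evidence \<mu>0 (\<Phi>N \<omega>) \<partial>\<nu>)"

definition marginal_posterior :: "'u measure \<Rightarrow> 'w measure \<Rightarrow> ('w \<Rightarrow> 'u \<Rightarrow> real) \<Rightarrow> 'u measure" where
  "marginal_posterior \<mu>0 \<nu> \<Phi>N =
     density \<mu>0 (\<lambda>u. mean_likelihood \<nu> \<Phi>N u / mean_evidence \<mu>0 \<nu> \<Phi>N)"

end

theory Submission
  imports Defs
begin

text \<open>
  Write \<open>h = exp (- \<Phi>)\<close> for the likelihood, \<open>k\<close> for the mean likelihood, \<open>Z\<close> and \<open>Z'\<close> for their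
  integrals against the prior, and \<open>d\<close> for the mixed norm of \<open>\<Phi> - \<Phi>N\<close> on the right-hand side.

  The elementary inequality \<open>\<bar>exp (- a) - exp (- b)\<bar> \<le> (exp (- a) + exp (- b)) \<bar>a - b\<bar>\<close> and the Holder
  inequality over the randomness give \<open>\<bar>h - k\<bar> \<le> g\<close>, where \<open>g\<close> is the product of the norm of
  \<open>exp (- \<Phi>) + exp (- \<Phi>N)\<close> with exponent \<open>p2\<close> and that of \<open>\<Phi> - \<Phi>N\<close> with exponent \<open>p2'\<close>
  (\<open>exp_minus_le_Lp_norm\<close>). A second use of the Holder inequality, over the prior
  with exponents \<open>p3\<close> and \<open>p3'\<close>, bounds the norm of \<open>g\<close> with exponent \<open>2 p1'\<close> by \<open>C2 d\<close>
  (\<open>Lp_norm_mult\<close>).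

  The Hellinger distance sees two effects. The change of density contributes the integral of
  \<open>(sqrt h - sqrt k)\<^sup>2 / Z\<close>; since \<open>(sqrt h - sqrt k)\<^sup>2\<close> is at most both \<open>g\<^sup>2 / h\<close> and \<open>g\<^sup>2 / k\<close>, a third
  use of the Holder inequality with \<open>p1\<close> and \<open>p1'\<close> bounds it by \<open>C1 (C2 d)\<^sup>2 / Z\<close>
  (\<open>nn_integral_sqrt_diff_square_le\<close>). The change of normalisation contributes at most
  \<open>(Z - Z')\<^sup>2 / Z\<^sup>2\<close>, and \<open>\<bar>Z - Z'\<bar>\<close> is at most the integral of \<open>g\<close>, hence at most \<open>C2 d\<close>. Together this
  bounds the square of the distance by \<open>(C1 / Z + 1 / Z\<^sup>2) (C2 d)\<^sup>2\<close> (\<open>hellinger_density_le\<close>).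

  Because \<open>C3 \<ge> 1\<close>, the term \<open>1 / Z\<^sup>2\<close> is at most \<open>C3 max (1 / Z\<^sup>3) (C3\<^sup>3)\<close>, so the factor of \<open>d\<^sup>2\<close>
  is at most \<open>C\<close>. It remains to pass from the square of the distance to the distance with a constant \<open>C\<close>
  that contains no square root, and for this \<open>C \<ge> 1\<close> is needed. The two-sided bound on \<open>Z'\<close> forces
  \<open>C3 \<ge> 1\<close>, and comparing the mixed norm that \<open>C2\<close> bounds with the mixed \<open>L\<^sup>1\<close> norm yields
  \<open>C2 \<ge> Z + Z' \<ge> 1 / C3\<close> (\<open>evidence_sum_le_Lp_norm\<close>). Hence \<open>C \<ge> C3\<^sup>4 C2\<^sup>2 \<ge> 1\<close>
  (\<open>hellinger_constant_dominates\<close>).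
\<close>

section \<open>Powers of extended nonnegative numbers\<close>

lemma ennreal_pow_top [simp]: "ennreal_pow \<infinity> r = \<infinity>" "ennreal_pow top r = top"
  by (simp_all add: ennreal_pow_def)

lemma ennreal_pow_ennreal [simp]: "0 \<le> x \<Longrightarrow> ennreal_pow (ennreal x) r = ennreal (x powr r)"
  by (simp add: ennreal_pow_def)

lemma ennreal_pow_zero [simp]: "ennreal_pow 0 r = 0"
  using ennreal_pow_ennreal[of 0 r] by simp

lemma ennreal_pow_1 [simp]: "ennreal_pow x 1 = x"
  by (cases x) (auto simp: )

lemma ennreal_pow_one [simp]: "ennreal_pow 1 r = 1"
  using ennreal_pow_ennreal[of 1 r] by simp

lemma ennreal_pow_2: "ennreal_pow x 2 = x * x"
  by (cases x) (auto simp: ennreal_mult[symmetric] power2_eq_square ennreal_mult_eq_top_iff ennreal_top_mult)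

lemma ennreal_pow_eq_0_iff [simp]: "ennreal_pow x r = 0 \<longleftrightarrow> x = 0"
  by (cases x) (auto simp: ennreal_eq_0_iff)

lemma ennreal_pow_mono: "0 \<le> r \<Longrightarrow> x \<le> y \<Longrightarrow> ennreal_pow x r \<le> ennreal_pow y r"
  by (cases x; cases y) (auto simp: top_unique intro!: ennreal_leI powr_mono2)

lemma ennreal_pow_pow: "ennreal_pow (ennreal_pow x r) s = ennreal_pow x (r * s)"
  by (cases x) (auto simp: powr_powr)

lemma ennreal_pow_mult: "ennreal_pow (x * y) r = ennreal_pow x r * ennreal_pow y r"
proof (cases "x = \<infinity> \<or> y = \<infinity>")
  case True
  then show ?thesis
    by (cases "x = 0 \<or> y = 0") (auto simp: ennreal_mult_top ennreal_top_mult)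
next
  case False
  then show ?thesis
    by (cases x; cases y) (auto simp: ennreal_mult[symmetric] powr_mult)
qed

lemma borel_measurable_ennreal_pow [measurable]:
  assumes [measurable]: "f \<in> borel_measurable M"
  shows "(\<lambda>x. ennreal_pow (f x) r) \<in> borel_measurable M"
  unfolding ennreal_pow_def by measurable

section \<open>Lp norms with exponents in [1, \<infinity>]\<close>

lemma conjugate_exponents_cases [consumes 1, case_names top_left top_right finite]:
  assumes "conjugate_exponents p p'"
  obtains "p = \<infinity>" "p' = 1" | "p = 1" "p' = \<infinity>"
    | a b where "p = ennreal a" "p' = ennreal b" "1 < a" "1 < b" "1 / a + 1 / b = 1"
proof -
  have *: "1 \<le> p" "1 \<le> p'" "inverse p + inverse p' = 1"
    using assms by (auto simp: conjugate_exponents_def)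
  have inv_1: "x = 1" if "inverse x = 1" "1 \<le> x" for x :: ennreal
    using that by (cases x) (auto simp: inverse_ennreal)
  show ?thesis
  proof (cases "p = \<infinity> \<or> p' = \<infinity>")
    case True
    then show ?thesis
      using * that(1,2) inv_1 by auto
  next
    case False
    then obtain a b where ab: "p = ennreal a" "p' = ennreal b" "1 \<le> a" "1 \<le> b"
      using * by (cases p; cases p') auto
    have "ennreal (inverse a + inverse b) = ennreal 1"
      using * ab by (simp add: inverse_ennreal)
    then have e: "1 / a + 1 / b = 1"
      using ab by (subst (asm) ennreal_inj) (auto simp: field_simps)
    have "a \<noteq> 1" "b \<noteq> 1" using e ab by auto
    then show ?thesis using that(3) ab e by auto
  qed
qed

lemma conjugate_exponents_sym: "conjugate_exponents p p' \<Longrightarrow> conjugate_exponents p' p"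
  by (simp add: conjugate_exponents_def add.commute)

lemma conjugate_exponents_2: "conjugate_exponents 2 2"
proof -
  have "inverse (2::ennreal) = ennreal (1 / 2)"
    using inverse_ennreal[of 2] by simp
  moreover have "ennreal (1 / 2) + ennreal (1 / 2) = 1"
    by (subst ennreal_plus[symmetric]) auto
  ultimately show ?thesis by (simp add: conjugate_exponents_def)
qed

lemma Lp_norm_1: "Lp_norm M 1 f = (\<integral>\<^sup>+x. f x \<partial>M)"
  by (simp add: Lp_norm_def)

lemma Lp_norm_const_1:
  assumes "prob_space M"
  shows "Lp_norm M p (\<lambda>_. 1) = 1"
proof -
  interpret prob_space M by fact
  show ?thesis by (simp add: Lp_norm_def esssup_const emeasure_space_1)
qed

text \<open>Both sides raise \<open>f\<close> to the same power before integrating; only for \<open>p = \<infinity>\<close> is there something to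
  prove, namely that an increasing bijection commutes with the essential supremum.\<close>

lemma Lp_norm_pow:
  assumes [measurable]: "f \<in> borel_measurable M" and r: "0 < r"
  shows "Lp_norm M (ennreal r * p) f = ennreal_pow (Lp_norm M p (\<lambda>x. ennreal_pow (f x) r)) (1 / r)"
proof (cases p)
  case top
  have pr: "ennreal r * p = \<infinity>" using r top by (simp add: ennreal_mult_top)
  let ?s = "esssup M f" and ?t = "esssup M (\<lambda>x. ennreal_pow (f x) r)"
  have "?s \<le> ennreal_pow ?t (1 / r)"
  proof (rule esssup_I)
    show "AE x in M. f x \<le> ennreal_pow ?t (1 / r)"
      using esssup_AE[of "\<lambda>x. ennreal_pow (f x) r" M]
    proof eventually_elim
      case (elim x)
      from ennreal_pow_mono[OF _ this, of "1 / r"] r show ?case by (simp add: ennreal_pow_pow)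
    qed
  qed simp
  moreover have "?t \<le> ennreal_pow ?s r"
  proof (rule esssup_I)
    show "AE x in M. ennreal_pow (f x) r \<le> ennreal_pow ?s r"
      using esssup_AE[of f M] by eventually_elim (use r in \<open>auto intro: ennreal_pow_mono\<close>)
  qed simp
  then have "ennreal_pow ?t (1 / r) \<le> ?s"
    using ennreal_pow_mono[of "1 / r" ?t "ennreal_pow ?s r"] r by (simp add: ennreal_pow_pow)
  ultimately show ?thesis using pr top by (simp add: Lp_norm_def)
next
  case (real q)
  then have "ennreal r * p = ennreal (r * q)" using r by (simp add: ennreal_mult)
  then show ?thesis using real r by (simp add: Lp_norm_def ennreal_pow_pow mult.commute)
qed

lemma Lp_norm_double:
  assumes "f \<in> borel_measurable M"
  shows "Lp_norm M p (\<lambda>x. f x * f x) = Lp_norm M (2 * p) f * Lp_norm M (2 * p) f"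
proof -
  have "Lp_norm M (2 * p) f = ennreal_pow (Lp_norm M p (\<lambda>x. f x * f x)) (1 / 2)"
    using Lp_norm_pow[of f M 2 p] assms by (simp add: ennreal_pow_2)
  then show ?thesis
    by (simp only: ennreal_pow_2[symmetric] ennreal_pow_pow) simp
qed

text \<open>For exponents in \<open>(1, \<infinity>)\<close>, Young's inequality, applied to \<open>f\<close> and \<open>g\<close> divided by their
  norms, bounds \<open>f g\<close> pointwise by a combination of \<open>f\<^sup>a\<close> and \<open>g\<^sup>b\<close> whose integral is the product of the norms. This needs both norms
  positive and finite. If one vanishes then so does the product almost everywhere; otherwise
  an infinite norm makes the right-hand side infinite.\<close>

lemma nn_integral_Holder:
  assumes [measurable]: "f \<in> borel_measurable M" "g \<in> borel_measurable M"
    and "conjugate_exponents p p'"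
  shows "(\<integral>\<^sup>+x. f x * g x \<partial>M) \<le> Lp_norm M p f * Lp_norm M p' g"
  using assms(3)
proof (cases rule: conjugate_exponents_cases)
  case top_left
  have "(\<integral>\<^sup>+x. f x * g x \<partial>M) \<le> (\<integral>\<^sup>+x. esssup M f * g x \<partial>M)"
    by (rule nn_integral_mono_AE) (use esssup_AE[of f M] in \<open>eventually_elim, auto intro: mult_right_mono\<close>)
  then show ?thesis using top_left by (simp add: Lp_norm_1 nn_integral_cmult) (simp add: Lp_norm_def)
next
  case top_right
  have "(\<integral>\<^sup>+x. f x * g x \<partial>M) \<le> (\<integral>\<^sup>+x. f x * esssup M g \<partial>M)"
    by (rule nn_integral_mono_AE) (use esssup_AE[of g M] in \<open>eventually_elim, auto intro: mult_left_mono\<close>)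
  then show ?thesis using top_right by (simp add: Lp_norm_1 nn_integral_multc) (simp add: Lp_norm_def)
next
  case (finite a b)
  define A where "A = (\<integral>\<^sup>+x. ennreal_pow (f x) a \<partial>M)"
  define B where "B = (\<integral>\<^sup>+x. ennreal_pow (g x) b \<partial>M)"
  have rhs: "Lp_norm M p f * Lp_norm M p' g = ennreal_pow A (1 / a) * ennreal_pow B (1 / b)"
    using finite by (simp add: Lp_norm_def A_def B_def)
  \<comment> \<open>The zero case goes first: there the right-hand side may be 0 times infinity, which is 0.\<close>
  consider "A = 0 \<or> B = 0" | "A \<noteq> 0" "B \<noteq> 0" "A = \<infinity> \<or> B = \<infinity>"
    | \<alpha> \<beta> where "A = ennreal \<alpha>" "B = ennreal \<beta>" "0 < \<alpha>" "0 < \<beta>"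
    by (cases A; cases B) (auto simp: ennreal_eq_0_iff less_le)
  then show ?thesis
  proof cases
    case 1
    then have "(AE x in M. f x = 0) \<or> (AE x in M. g x = 0)"
      unfolding A_def B_def by (auto simp: nn_integral_0_iff_AE)
    then have "AE x in M. f x * g x = 0" by auto
    then have "(\<integral>\<^sup>+x. f x * g x \<partial>M) = 0" by (simp add: nn_integral_0_iff_AE)
    then show ?thesis by simp
  next
    case 2
    then have "ennreal_pow A (1 / a) * ennreal_pow B (1 / b) = \<infinity>"
      by (auto simp: ennreal_mult_top ennreal_top_mult)
    then show ?thesis using rhs by simp
  next
    case (3 \<alpha> \<beta>)
    define s where "s = \<alpha> powr (1 / a)"
    define t where "t = \<beta> powr (1 / b)"
    have st: "0 < s" "0 < t" using 3 by (auto simp: s_def t_def)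
    have young: "f x * g x \<le> ennreal (s * t / (a * \<alpha>)) * ennreal_pow (f x) a
                             + ennreal (s * t / (b * \<beta>)) * ennreal_pow (g x) b" for x
    proof (cases "f x = \<infinity> \<or> g x = \<infinity>")
      case True
      then show ?thesis using 3 st finite by (auto simp: ennreal_mult_top)
    next
      case False
      then obtain y z where yz: "f x = ennreal y" "g x = ennreal z" "0 \<le> y" "0 \<le> z"
        by (cases "f x"; cases "g x") auto
      have "(y / s) * (z / t) \<le> (y / s) powr a / a + (z / t) powr b / b"
        using finite yz st by (intro Youngs_inequality) auto
      also have "\<dots> = y powr a / (a * \<alpha>) + z powr b / (b * \<beta>)"
        using finite yz st 3 by (simp add: powr_divide s_def t_def powr_powr mult.commute)
      finally have "(y / s) * (z / t) * (s * t) \<le> (y powr a / (a * \<alpha>) + z powr b / (b * \<beta>)) * (s * t)"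
        using st by (intro mult_right_mono) auto
      then have "y * z \<le> s * t / (a * \<alpha>) * y powr a + s * t / (b * \<beta>) * z powr b"
        using st by (simp add: algebra_simps)
      then show ?thesis using yz st 3 finite
        by (simp add: ennreal_mult[symmetric] ennreal_plus[symmetric] del: ennreal_plus)
    qed
    have "(\<integral>\<^sup>+x. f x * g x \<partial>M) \<le> (\<integral>\<^sup>+x. ennreal (s * t / (a * \<alpha>)) * ennreal_pow (f x) a
                             + ennreal (s * t / (b * \<beta>)) * ennreal_pow (g x) b \<partial>M)"
      by (intro nn_integral_mono young)
    also have "\<dots> = ennreal (s * t / (a * \<alpha>)) * A + ennreal (s * t / (b * \<beta>)) * B"
      unfolding A_def B_def by (simp add: nn_integral_add nn_integral_cmult)
    also have "\<dots> = ennreal (s * t * (1 / a + 1 / b))"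
      using 3 st finite by (simp add: ennreal_mult[symmetric] ennreal_plus[symmetric] field_simps del: ennreal_plus)
    also have "\<dots> = Lp_norm M p f * Lp_norm M p' g"
      using 3 finite(5) by (simp add: rhs s_def t_def ennreal_mult)
    finally show ?thesis .
  qed
qed

text \<open>For finite \<open>r\<close> this is the ordinary inequality for \<open>f\<^sup>r\<close> and \<open>g\<^sup>r\<close>. The case \<open>r = \<infinity>\<close> is genuinely
  separate and says that the essential supremum is submultiplicative.\<close>

lemma Lp_norm_mult:
  assumes [measurable]: "f \<in> borel_measurable M" "g \<in> borel_measurable M"
    and pp': "conjugate_exponents p p'" and r: "1 \<le> r"
  shows "Lp_norm M r (\<lambda>x. f x * g x) \<le> Lp_norm M (r * p) f * Lp_norm M (r * p') g"
proof -
  have p: "1 \<le> p" "1 \<le> p'" using pp' by (auto simp: conjugate_exponents_def)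
  show ?thesis
  proof (cases r)
    case top
    have "r * p = \<infinity>" "r * p' = \<infinity>" using p top by (auto simp: ennreal_top_mult)
    moreover have "esssup M (\<lambda>x. f x * g x) \<le> esssup M f * esssup M g"
    proof (rule esssup_I)
      show "AE x in M. f x * g x \<le> esssup M f * esssup M g"
        using esssup_AE[of f M] esssup_AE[of g M] by eventually_elim (rule mult_mono, auto)
    qed simp
    ultimately show ?thesis using top by (simp add: Lp_norm_def)
  next
    case (real q)
    then have q: "1 \<le> q" using r by simp
    have "Lp_norm M r (\<lambda>x. f x * g x) = ennreal_pow (\<integral>\<^sup>+x. ennreal_pow (f x) q * ennreal_pow (g x) q \<partial>M) (1 / q)"
      using real by (simp add: Lp_norm_def ennreal_pow_mult)
    also have "\<dots> \<le> ennreal_pow (Lp_norm M p (\<lambda>x. ennreal_pow (f x) q) * Lp_norm M p' (\<lambda>x. ennreal_pow (g x) q)) (1 / q)"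
      using q pp' by (intro ennreal_pow_mono nn_integral_Holder) auto
    also have "\<dots> = Lp_norm M (r * p) f * Lp_norm M (r * p') g"
      using q real by (simp add: ennreal_pow_mult Lp_norm_pow)
    finally show ?thesis .
  qed
qed

text \<open>On a probability space the norm increases with the exponent, as one sees by pairing \<open>f\<close> with
  the constant 1. Writing the larger exponent as a multiple of the smaller one fits the
  exponents \<open>2 p\<^sub>1' p\<^sub>3\<close> and \<open>2 p\<^sub>1' p\<^sub>3'\<close> and avoids a division in the extended half-line.\<close>

lemma Lp_norm_le_mult_exponent:
  assumes "prob_space M" "f \<in> borel_measurable M" "conjugate_exponents p p'" "1 \<le> r"
  shows "Lp_norm M r f \<le> Lp_norm M (r * p) f"
  using Lp_norm_mult[of f M "\<lambda>_. 1" p p' r] assms by (simp add: Lp_norm_const_1)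

lemma nn_integral_le_Lp_norm:
  assumes M: "prob_space M" and f: "f \<in> borel_measurable M" and pp': "conjugate_exponents p p'"
  shows "(\<integral>\<^sup>+x. f x \<partial>M) \<le> Lp_norm M (2 * p') f"
proof -
  have "1 \<le> p'" using pp' by (simp add: conjugate_exponents_def)
  have "(\<integral>\<^sup>+x. f x \<partial>M) \<le> Lp_norm M p' f"
    using Lp_norm_le_mult_exponent[OF M f conjugate_exponents_sym[OF pp'] order_refl]
    by (simp add: Lp_norm_1)
  also have "\<dots> \<le> Lp_norm M (2 * p') f"
    using Lp_norm_le_mult_exponent[OF M f conjugate_exponents_2 \<open>1 \<le> p'\<close>] by (simp add: mult.commute)
  finally show ?thesis .
qed

text \<open>For \<open>p = \<infinity>\<close>, the essential supremum of a section is at most \<open>c\<close> exactly when the section exceeds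
  \<open>c\<close> on a null set, and the measure of that exceptional set depends measurably on the parameter.\<close>

lemma borel_measurable_Lp_norm:
  assumes "sigma_finite_measure N"
    and [measurable]: "(\<lambda>(x, y). f x y) \<in> borel_measurable (M \<Otimes>\<^sub>M N)"
  shows "(\<lambda>x. Lp_norm N p (f x)) \<in> borel_measurable M"
proof -
  interpret sigma_finite_measure N by fact
  show ?thesis
  proof (cases "p = \<infinity>")
    case False
    then show ?thesis by (simp add: Lp_norm_def)
  next
    case True
    have "(\<lambda>x. esssup N (f x)) \<in> borel_measurable M"
    proof (rule borel_measurableI_le)
      fix c :: ennreal
      have "esssup N (f x) \<le> c \<longleftrightarrow> (\<integral>\<^sup>+y. indicator {c<..} (f x y) \<partial>N) = (0::ennreal)" if "x \<in> space M" for x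
      proof -
        have [measurable]: "f x \<in> borel_measurable N" using that by measurable
        have "esssup N (f x) \<le> c \<longleftrightarrow> (AE y in N. f x y \<le> c)"
          using esssup_AE[of "f x" N] by (auto intro: order_trans)
        also have "\<dots> \<longleftrightarrow> (\<integral>\<^sup>+y. indicator {c<..} (f x y) \<partial>N) = (0::ennreal)"
          by (subst nn_integral_0_iff_AE) (auto simp: indicator_eq_0_iff not_less)
        finally show ?thesis .
      qed
      then have "{x \<in> space M. esssup N (f x) \<le> c} =
          {x \<in> space M. (\<integral>\<^sup>+y. indicator {c<..} (f x y) \<partial>N) = (0::ennreal)}" by auto
      also have "\<dots> \<in> sets M" by measurable
      finally show "{x \<in> space M. esssup N (f x) \<le> c} \<in> sets M" .
    qed
    then show ?thesis using True by (simp add: Lp_norm_def)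
  qed
qed

section \<open>Pointwise comparison of the likelihoods\<close>

lemma abs_exp_minus_diff_le:
  fixes a b :: real
  shows "\<bar>exp (- a) - exp (- b)\<bar> \<le> (exp (- a) + exp (- b)) * \<bar>a - b\<bar>"
proof -
  have *: "\<bar>exp (- x) - exp (- y)\<bar> \<le> (exp (- x) + exp (- y)) * \<bar>x - y\<bar>" if "x \<le> y" for x y :: real
  proof -
    have "exp (- x) * (1 + (x - y)) \<le> exp (- x) * exp (x - y)"
      by (intro mult_left_mono exp_ge_add_one_self) auto
    also have "exp (- x) * exp (x - y) = exp (- y)" by (simp add: exp_add[symmetric])
    finally have "exp (- x) * (1 + (x - y)) \<le> exp (- y)" .
    then have "exp (- x) - exp (- y) \<le> exp (- x) * (y - x)" by (simp add: algebra_simps)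
    also have "\<dots> \<le> (exp (- x) + exp (- y)) * (y - x)"
      using that by (intro mult_right_mono) auto
    finally show ?thesis using that by simp
  qed
  show ?thesis
    using *[of a b] *[of b a] by (cases "a \<le> b") (auto simp: abs_minus_commute add.commute)
qed

text \<open>The average of \<open>exp (- f x)\<close> differs from \<open>exp (- a)\<close> by at most the average of
  \<open>(exp (- a) + exp (- f x)) \<bar>a - f x\<bar>\<close>, which the Holder inequality splits into two norms.
  The bound is given as two inequalities without subtraction because the average may be infinite.\<close>

lemma exp_minus_le_Lp_norm:
  fixes a :: real
  assumes "prob_space M" and [measurable]: "f \<in> borel_measurable M"
    and pp': "conjugate_exponents p p'"
  defines "G \<equiv> Lp_norm M p (\<lambda>x. ennreal (exp (- a) + exp (- f x)))
             * Lp_norm M p' (\<lambda>x. ennreal \<bar>a - f x\<bar>)"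
  shows "ennreal (exp (- a)) \<le> (\<integral>\<^sup>+x. ennreal (exp (- f x)) \<partial>M) + G"
    and "(\<integral>\<^sup>+x. ennreal (exp (- f x)) \<partial>M) \<le> ennreal (exp (- a)) + G"
proof -
  interpret prob_space M by fact
  let ?g = "\<lambda>x. ennreal (exp (- a) + exp (- f x)) * ennreal \<bar>a - f x\<bar>"
  have G: "(\<integral>\<^sup>+x. ?g x \<partial>M) \<le> G"
    unfolding G_def by (intro nn_integral_Holder pp') auto
  have le: "ennreal (exp (- a)) \<le> ennreal (exp (- f x)) + ?g x"
    "ennreal (exp (- f x)) \<le> ennreal (exp (- a)) + ?g x" for x
    using abs_exp_minus_diff_le[of a "f x"]
    by (auto simp: ennreal_mult[symmetric] ennreal_plus[symmetric] simp del: ennreal_plus intro!: ennreal_leI)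
  have "ennreal (exp (- a)) = (\<integral>\<^sup>+x. ennreal (exp (- a)) \<partial>M)" by (simp add: emeasure_space_1)
  also have "\<dots> \<le> (\<integral>\<^sup>+x. ennreal (exp (- f x)) + ?g x \<partial>M)" by (intro nn_integral_mono le)
  also have "\<dots> = (\<integral>\<^sup>+x. ennreal (exp (- f x)) \<partial>M) + (\<integral>\<^sup>+x. ?g x \<partial>M)" by (intro nn_integral_add) auto
  finally show "ennreal (exp (- a)) \<le> (\<integral>\<^sup>+x. ennreal (exp (- f x)) \<partial>M) + G"
    using add_left_mono[OF G] order_trans by blast
  have "(\<integral>\<^sup>+x. ennreal (exp (- f x)) \<partial>M) \<le> (\<integral>\<^sup>+x. ennreal (exp (- a)) + ?g x \<partial>M)" by (intro nn_integral_mono le)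
  also have "\<dots> = (\<integral>\<^sup>+x. ennreal (exp (- a)) \<partial>M) + (\<integral>\<^sup>+x. ?g x \<partial>M)" by (intro nn_integral_add) auto
  also have "\<dots> = ennreal (exp (- a)) + (\<integral>\<^sup>+x. ?g x \<partial>M)" by (simp add: emeasure_space_1)
  finally show "(\<integral>\<^sup>+x. ennreal (exp (- f x)) \<partial>M) \<le> ennreal (exp (- a)) + G"
    using add_left_mono[OF G] order_trans by blast
qed

text \<open>Since \<open>x - y = (sqrt x - sqrt y) (sqrt x + sqrt y)\<close> and the second factor is at least \<open>sqrt x\<close>,
  division by that factor costs at most \<open>1 / x\<close> after squaring.\<close>

lemma sqrt_diff_square_le:
  fixes x y d :: real
  assumes "0 < x" "0 \<le> y" "\<bar>x - y\<bar> \<le> d"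
  shows "(sqrt x - sqrt y)\<^sup>2 \<le> d\<^sup>2 / x"
proof -
  have "x - y = (sqrt x - sqrt y) * (sqrt x + sqrt y)"
    using assms by (simp add: algebra_simps)
  then have "(x - y)\<^sup>2 = (sqrt x - sqrt y)\<^sup>2 * (sqrt x + sqrt y)\<^sup>2"
    by (simp add: power_mult_distrib)
  moreover have "x \<le> (sqrt x + sqrt y)\<^sup>2" using assms by (simp add: power2_sum)
  then have "(sqrt x - sqrt y)\<^sup>2 * x \<le> (sqrt x - sqrt y)\<^sup>2 * (sqrt x + sqrt y)\<^sup>2"
    by (intro mult_left_mono) auto
  moreover have "(x - y)\<^sup>2 \<le> d\<^sup>2" using assms by (simp add: abs_le_square_iff[symmetric])
  ultimately show ?thesis using assms by (simp add: pos_le_divide_eq)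
qed

lemma ennreal_abs_diff_le:
  fixes x y d :: real
  assumes "0 \<le> x" "0 \<le> y" "0 \<le> d"
    "ennreal x \<le> ennreal y + ennreal d" "ennreal y \<le> ennreal x + ennreal d"
  shows "\<bar>x - y\<bar> \<le> d"
  using assms by (auto simp: ennreal_plus[symmetric] simp del: ennreal_plus)

lemma ennreal_sqrt_diff_square_le:
  fixes x y g :: ennreal
  assumes "0 < x" "x < \<infinity>" "y < \<infinity>" "x \<le> y + g" "y \<le> x + g"
  shows "ennreal ((sqrt (enn2real x) - sqrt (enn2real y))\<^sup>2) \<le> inverse x * (g * g)"
proof (cases g)
  case top
  have "inverse x \<noteq> 0" using assms by auto
  then show ?thesis using top by (simp add: ennreal_mult_top)
next
  case (real d)
  obtain a b where ab: "x = ennreal a" "y = ennreal b" "0 < a" "0 \<le> b"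
    using assms by (cases x; cases y) auto
  have "(sqrt a - sqrt b)\<^sup>2 \<le> d\<^sup>2 / a"
    using assms ab real by (intro sqrt_diff_square_le ennreal_abs_diff_le) auto
  then have "ennreal ((sqrt a - sqrt b)\<^sup>2) \<le> ennreal (inverse a * (d * d))"
    by (intro ennreal_leI) (simp add: power2_eq_square field_simps)
  also have "\<dots> = inverse x * (g * g)" using ab real by (simp add: ennreal_mult inverse_ennreal)
  finally show ?thesis using ab by simp
qed

section \<open>Hellinger distance of normalised densities\<close>

lemma nn_integral_weighted_square_le:
  assumes [measurable]: "w \<in> borel_measurable M" "g \<in> borel_measurable M"
    and "conjugate_exponents p p'"
  shows "(\<integral>\<^sup>+x. w x * (g x * g x) \<partial>M) \<le> Lp_norm M p w * (Lp_norm M (2 * p') g * Lp_norm M (2 * p') g)"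
  using nn_integral_Holder[of w M "\<lambda>x. g x * g x" p p'] assms by (simp add: Lp_norm_double)

text \<open>The roles of \<open>h\<close> and \<open>k\<close> are symmetric, so the squared difference of the square roots is bounded
  both by \<open>g\<^sup>2 / h\<close> and by \<open>g\<^sup>2 / k\<close>, and the smaller of the two resulting estimates may be used.\<close>

lemma nn_integral_sqrt_diff_square_le:
  assumes [measurable]: "h \<in> borel_measurable M" "k \<in> borel_measurable M" "g \<in> borel_measurable M"
    and pp': "conjugate_exponents p p'"
    and pos: "\<And>x. x \<in> space M \<Longrightarrow> 0 < h x" "\<And>x. x \<in> space M \<Longrightarrow> 0 < k x"
    and fin: "AE x in M. h x < \<infinity>" "AE x in M. k x < \<infinity>"
    and close: "\<And>x. x \<in> space M \<Longrightarrow> h x \<le> k x + g x"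
      "\<And>x. x \<in> space M \<Longrightarrow> k x \<le> h x + g x"
  shows "(\<integral>\<^sup>+x. ennreal ((sqrt (enn2real (h x)) - sqrt (enn2real (k x)))\<^sup>2) \<partial>M)
    \<le> min (Lp_norm M p (\<lambda>x. inverse (k x))) (Lp_norm M p (\<lambda>x. inverse (h x)))
        * (Lp_norm M (2 * p') g * Lp_norm M (2 * p') g)" (is "?I \<le> _")
proof -
  have "?I \<le> (\<integral>\<^sup>+x. inverse (h x) * (g x * g x) \<partial>M)"
    by (rule nn_integral_mono_AE)
      (use fin AE_space in \<open>eventually_elim, intro ennreal_sqrt_diff_square_le pos close\<close>)
  also have "\<dots> \<le> Lp_norm M p (\<lambda>x. inverse (h x)) * (Lp_norm M (2 * p') g * Lp_norm M (2 * p') g)"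
    by (intro nn_integral_weighted_square_le pp') auto
  finally have 1: "?I \<le> Lp_norm M p (\<lambda>x. inverse (h x)) * (Lp_norm M (2 * p') g * Lp_norm M (2 * p') g)" .
  have "?I \<le> (\<integral>\<^sup>+x. inverse (k x) * (g x * g x) \<partial>M)"
    by (rule nn_integral_mono_AE)
      (use fin AE_space in \<open>eventually_elim, subst power2_commute, intro ennreal_sqrt_diff_square_le pos close\<close>)
  also have "\<dots> \<le> Lp_norm M p (\<lambda>x. inverse (k x)) * (Lp_norm M (2 * p') g * Lp_norm M (2 * p') g)"
    by (intro nn_integral_weighted_square_le pp') auto
  finally show ?thesis using 1 by (simp add: min_def)
qed

text \<open>The difference splits into a change of density, \<open>(sqrt x - sqrt y) / sqrt Z\<close>, and a change of
  normalisation, \<open>sqrt y (1 / sqrt Z - 1 / sqrt Z')\<close>. The factor \<open>1 / Z'\<close> is kept in the second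
  term because it cancels when \<open>y\<close> is integrated.\<close>

lemma normalised_sqrt_diff_square_le:
  fixes x y Z Z' :: real
  assumes "0 \<le> x" "0 \<le> y" "0 < Z" "0 < Z'"
  shows "(sqrt (x / Z) - sqrt (y / Z'))\<^sup>2
    \<le> 2 / Z * (sqrt x - sqrt y)\<^sup>2 + 2 * (Z - Z')\<^sup>2 / (Z\<^sup>2 * Z') * y"
proof -
  define a where "a = (sqrt x - sqrt y) / sqrt Z"
  define b where "b = sqrt y * (sqrt Z' - sqrt Z) / (sqrt Z * sqrt Z')"
  have "sqrt (x / Z) - sqrt (y / Z') = a + b"
    using assms by (simp add: a_def b_def real_sqrt_divide field_simps)
  moreover have "(a + b)\<^sup>2 \<le> 2 * a\<^sup>2 + 2 * b\<^sup>2"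
    using zero_le_power2[of "a - b"] by (simp add: power2_sum power2_diff)
  moreover have "a\<^sup>2 = (sqrt x - sqrt y)\<^sup>2 / Z"
    using assms by (simp add: a_def power_divide)
  moreover have "b\<^sup>2 = y * (sqrt Z - sqrt Z')\<^sup>2 / (Z * Z')"
    using assms by (simp add: b_def power_divide power_mult_distrib power2_commute)
  moreover have "y * (sqrt Z - sqrt Z')\<^sup>2 / (Z * Z') \<le> y * ((Z - Z')\<^sup>2 / Z) / (Z * Z')"
    using assms sqrt_diff_square_le[of Z Z' "\<bar>Z - Z'\<bar>"]
    by (intro divide_right_mono mult_left_mono) auto
  moreover have "y * ((Z - Z')\<^sup>2 / Z) / (Z * Z') = (Z - Z')\<^sup>2 / (Z\<^sup>2 * Z') * y"
    using assms by (simp add: power2_eq_square mult_ac)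
  ultimately show ?thesis by simp
qed

lemma hellinger_density_le:
  assumes M: "sigma_finite_measure M"
    and [measurable]: "h \<in> borel_measurable M" "k \<in> borel_measurable M"
    and Z: "0 < Z" "(\<integral>\<^sup>+x. h x \<partial>M) = ennreal Z" and Z': "0 < Z'" "(\<integral>\<^sup>+x. k x \<partial>M) = ennreal Z'"
    and I: "(\<integral>\<^sup>+x. ennreal ((sqrt (enn2real (h x)) - sqrt (enn2real (k x)))\<^sup>2) \<partial>M) \<le> ennreal I" "0 \<le> I"
  shows "hellinger M (density M (\<lambda>x. h x / ennreal Z)) (density M (\<lambda>x. k x / ennreal Z'))
    \<le> sqrt (I / Z + (Z - Z')\<^sup>2 / Z\<^sup>2)"
proof -
  interpret sigma_finite_measure M by fact
  let ?R = "\<lambda>x. \<bar>sqrt (enn2real (RN_deriv M (density M (\<lambda>x. h x / ennreal Z)) x))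
              - sqrt (enn2real (RN_deriv M (density M (\<lambda>x. k x / ennreal Z')) x))\<bar>\<^sup>2"
  let ?c = "2 * (Z - Z')\<^sup>2 / (Z\<^sup>2 * Z')"
  have fin: "AE x in M. k x \<noteq> \<infinity>" "AE x in M. h x \<noteq> \<infinity>"
    using Z Z' by (intro nn_integral_PInf_AE; simp)+
  have RN: "AE x in M. h x / ennreal Z = RN_deriv M (density M (\<lambda>x. h x / ennreal Z)) x"
    "AE x in M. k x / ennreal Z' = RN_deriv M (density M (\<lambda>x. k x / ennreal Z')) x"
    by (intro RN_deriv_unique; simp)+
  have "AE x in M. ennreal (?R x) \<le> ennreal (2 / Z) * ennreal ((sqrt (enn2real (h x)) - sqrt (enn2real (k x)))\<^sup>2)
      + ennreal ?c * k x"
    using RN fin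
  proof eventually_elim
    case (elim x)
    then obtain y z where yz: "h x = ennreal y" "k x = ennreal z" "0 \<le> y" "0 \<le> z"
      by (cases "h x"; cases "k x") auto
    have "?R x = (sqrt (y / Z) - sqrt (z / Z'))\<^sup>2"
      using elim(1,2)[symmetric] yz Z Z' by (simp add: divide_ennreal)
    then show ?case
      using normalised_sqrt_diff_square_le[of y z Z Z'] yz Z Z'
      by (simp add: ennreal_mult[symmetric] ennreal_plus[symmetric] del: ennreal_plus)
  qed
  then have "(\<integral>\<^sup>+x. ennreal (?R x) \<partial>M) \<le>
      (\<integral>\<^sup>+x. ennreal (2 / Z) * ennreal ((sqrt (enn2real (h x)) - sqrt (enn2real (k x)))\<^sup>2) + ennreal ?c * k x \<partial>M)"
    by (rule nn_integral_mono_AE)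
  also have "\<dots> = ennreal (2 / Z) * (\<integral>\<^sup>+x. ennreal ((sqrt (enn2real (h x)) - sqrt (enn2real (k x)))\<^sup>2) \<partial>M)
      + ennreal ?c * ennreal Z'"
    by (simp add: nn_integral_add nn_integral_cmult Z')
  also have "\<dots> \<le> ennreal (2 / Z) * ennreal I + ennreal ?c * ennreal Z'"
    by (intro add_right_mono mult_left_mono I) auto
  also have "\<dots> = ennreal (2 * (I / Z + (Z - Z')\<^sup>2 / Z\<^sup>2))"
    using Z Z' I by (simp add: ennreal_mult[symmetric] ennreal_plus[symmetric] field_simps del: ennreal_plus)
  finally have "(\<integral>x. ?R x \<partial>M) \<le> 2 * (I / Z + (Z - Z')\<^sup>2 / Z\<^sup>2)"
    using Z I by (intro integral_real_bounded) auto
  moreover have "1 / 2 * r \<le> t" if "r \<le> 2 * t" for r t :: real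
    using that by simp
  ultimately show ?thesis unfolding hellinger_def by (intro real_sqrt_le_mono)
qed

section \<open>The constant and the error bound\<close>

text \<open>The natural estimate of the squared distance is \<open>A d\<^sup>2\<close> with \<open>A = (C1 / Z + 1 / Z\<^sup>2) C2\<^sup>2\<close>, so the
  distance itself is at most \<open>sqrt A d\<close>, whereas the asserted constant \<open>C\<close> carries no square root.
  One has \<open>A \<le> C\<close>, and \<open>sqrt C \<le> C\<close> follows from \<open>C \<ge> C3\<^sup>4 C2\<^sup>2 \<ge> C3\<^sup>2 \<ge> 1\<close>.\<close>

lemma hellinger_constant_dominates:
  fixes C1 C2 C3 Z d :: real
  assumes "0 < Z" "0 \<le> C1" "1 \<le> C3" "1 / C3 \<le> C2" "0 \<le> d"
  defines "C \<equiv> (C1 / Z + C3 * max (1 / Z ^ 3) (C3 ^ 3)) * C2\<^sup>2"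
  shows "1 \<le> C" and "sqrt (C1 * (C2 * d)\<^sup>2 / Z + (C2 * d)\<^sup>2 / Z\<^sup>2) \<le> C * d"
proof -
  define m where "m = max (1 / Z ^ 3) (C3 ^ 3)"
  have m: "0 \<le> m" using assms by (simp add: m_def le_max_iff_disj)
  \<comment> \<open>If \<open>1 / Z > C3\<close> then \<open>1 / Z \<ge> 1\<close>, so the cube dominates the square; otherwise \<open>C3\<close> dominates \<open>1 / Z\<close>.\<close>
  have "1 / Z\<^sup>2 \<le> C3 * m"
  proof (cases "1 / Z \<le> C3")
    case True
    have "(1 / Z)\<^sup>2 \<le> C3\<^sup>2" using True assms by (intro power_mono) auto
    also have "\<dots> \<le> C3 ^ 4" using assms by (intro power_increasing) auto
    also have "\<dots> = C3 * C3 ^ 3" by (simp add: eval_nat_numeral)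
    also have "\<dots> \<le> C3 * m" using assms by (intro mult_left_mono) (auto simp: m_def)
    finally show ?thesis by (simp add: power_divide)
  next
    case False
    then have "1 \<le> 1 / Z" using assms by linarith
    then have "(1 / Z)\<^sup>2 \<le> (1 / Z) ^ 3" by (intro power_increasing) auto
    also have "\<dots> \<le> m" by (simp add: m_def power_divide)
    also have "\<dots> \<le> C3 * m" using assms by (auto simp: m_def mult_le_cancel_right1 max_def)
    finally show ?thesis by (simp add: power_divide)
  qed
  then have "(C1 / Z + 1 / Z\<^sup>2) * C2\<^sup>2 \<le> C"
    unfolding C_def m_def[symmetric] by (intro mult_right_mono) auto
  then have le: "(C1 / Z + 1 / Z\<^sup>2) * C2\<^sup>2 * d\<^sup>2 \<le> C * d\<^sup>2" by (rule mult_right_mono) simp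
  have "1 \<le> C3 * C3 ^ 3 * (1 / C3)\<^sup>2"
    using assms by (simp add: field_simps power2_eq_square eval_nat_numeral) (metis mult_mono' mult_1 zero_le_one)
  also have "\<dots> \<le> C3 * m * C2\<^sup>2"
    using assms m by (intro mult_mono power_mono mult_nonneg_nonneg) (auto simp: m_def)
  also have "\<dots> \<le> C"
    unfolding C_def m_def[symmetric] using assms by (intro mult_right_mono) auto
  finally show 1: "1 \<le> C" .
  have "C1 * (C2 * d)\<^sup>2 / Z + (C2 * d)\<^sup>2 / Z\<^sup>2 = (C1 / Z + 1 / Z\<^sup>2) * C2\<^sup>2 * d\<^sup>2"
    by (simp add: field_simps power_mult_distrib)
  also note le
  also have "C * d\<^sup>2 \<le> C\<^sup>2 * d\<^sup>2"
    using 1 self_le_power[of C 2] by (intro mult_right_mono) auto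
  also have "\<dots> = (C * d)\<^sup>2" by (simp add: power_mult_distrib)
  finally show "sqrt (C1 * (C2 * d)\<^sup>2 / Z + (C2 * d)\<^sup>2 / Z\<^sup>2) \<le> C * d"
    using 1 assms by (intro real_le_lsqrt) auto
qed

lemma nn_integral_mean_likelihood:
  assumes "sigma_finite_measure M" "sigma_finite_measure N"
    and "(\<lambda>(\<omega>, u). f \<omega> u) \<in> borel_measurable (N \<Otimes>\<^sub>M M)"
  shows "(\<integral>\<^sup>+u. mean_likelihood N f u \<partial>M) = mean_evidence M N f"
proof -
  interpret N: sigma_finite_measure N by fact
  interpret M: sigma_finite_measure M by fact
  interpret pair_sigma_finite N M ..
  note [measurable] = assms(3)
  show ?thesis
    unfolding mean_likelihood_def mean_evidence_def evidence_def by (rule Fubini') measurable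
qed

text \<open>The left-hand side is the \<open>L\<^sup>1\<close> norm over the product space of the function whose mixed norm
  stands on the right. It bounds the constant \<open>C2\<close> from below, which is what makes the final
  constant at least 1.\<close>

lemma evidence_sum_le_Lp_norm:
  assumes M: "prob_space M" and N: "prob_space N"
    and [measurable]: "\<Phi> \<in> borel_measurable M" "(\<lambda>(u, \<omega>). f \<omega> u) \<in> borel_measurable (M \<Otimes>\<^sub>M N)"
    and conj: "conjugate_exponents p1 p1'" "conjugate_exponents p2 p2'" "conjugate_exponents p3 p3'"
  shows "evidence M \<Phi> + (\<integral>\<^sup>+u. mean_likelihood N f u \<partial>M)
    \<le> Lp_norm M (2 * p1' * p3) (\<lambda>u. Lp_norm N p2 (\<lambda>\<omega>. ennreal (exp (- \<Phi> u) + exp (- f \<omega> u))))"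
proof -
  interpret N: prob_space N by fact
  let ?s = "\<lambda>u. Lp_norm N p2 (\<lambda>\<omega>. ennreal (exp (- \<Phi> u) + exp (- f \<omega> u)))"
  have [measurable]: "?s \<in> borel_measurable M"
    by (intro borel_measurable_Lp_norm N.sigma_finite_measure_axioms) measurable
  have [measurable]: "mean_likelihood N f \<in> borel_measurable M"
    unfolding mean_likelihood_def by measurable
  have p1': "1 \<le> 2 * p1'"
    using conj(1) mult_mono[of 1 2 1 p1'] by (auto simp: conjugate_exponents_def)
  have "ennreal (exp (- \<Phi> u)) + mean_likelihood N f u \<le> ?s u" if u: "u \<in> space M" for u
  proof -
    have [measurable]: "(\<lambda>\<omega>. f \<omega> u) \<in> borel_measurable N" using u by measurable
    have "ennreal (exp (- \<Phi> u)) + mean_likelihood N f u = Lp_norm N 1 (\<lambda>\<omega>. ennreal (exp (- \<Phi> u) + exp (- f \<omega> u)))"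
      by (simp add: Lp_norm_1 mean_likelihood_def nn_integral_add N.emeasure_space_1)
    also have "\<dots> \<le> ?s u"
      using Lp_norm_le_mult_exponent[OF N _ conj(2), of _ 1] by simp
    finally show ?thesis .
  qed
  then have "(\<integral>\<^sup>+u. ennreal (exp (- \<Phi> u)) + mean_likelihood N f u \<partial>M) \<le> (\<integral>\<^sup>+u. ?s u \<partial>M)"
    by (intro nn_integral_mono)
  also have "\<dots> \<le> Lp_norm M (2 * p1') ?s"
    by (rule nn_integral_le_Lp_norm[OF M _ conj(1)]) measurable
  also have "\<dots> \<le> Lp_norm M (2 * p1' * p3) ?s"
    by (rule Lp_norm_le_mult_exponent[OF M _ conj(3) p1']) measurable
  finally show ?thesis by (simp add: nn_integral_add evidence_def)
qed

text \<open>Let \<open>h\<close> be the likelihood, \<open>k\<close> the mean likelihood and \<open>g = s e\<close> the pointwise bound on their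
  difference, with \<open>s\<close> the norm of the sum of likelihoods and \<open>e\<close> that of the error. Then
  the norm of \<open>g\<close> with exponent \<open>2 p1'\<close> is at most \<open>C2 d\<close>, where \<open>d\<close> is the mixed norm of the error, and
  this single number controls both the change of density and the change of normalisation.\<close>

lemma hellinger_marginal_posterior_le:
  fixes Z C1 C2 C3 :: real
  assumes M: "prob_space M" and N: "prob_space N"
    and \<Phi>[measurable]: "\<Phi> \<in> borel_measurable M"
    and f[measurable]: "(\<lambda>(\<omega>, u). f \<omega> u) \<in> borel_measurable (N \<Otimes>\<^sub>M M)"
    and Z: "0 < Z" "evidence M \<Phi> = ennreal Z"
    and conj: "conjugate_exponents p1 p1'" "conjugate_exponents p2 p2'" "conjugate_exponents p3 p3'"
    and nonneg: "0 \<le> C1" "0 \<le> C2" "0 \<le> C3"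
    and a: "min (Lp_norm M p1 (\<lambda>u. inverse (mean_likelihood N f u)))
                (Lp_norm M p1 (\<lambda>u. ennreal (exp (\<Phi> u)))) \<le> ennreal C1"
    and b: "Lp_norm M (2 * p1' * p3)
              (\<lambda>u. Lp_norm N p2 (\<lambda>\<omega>. ennreal (exp (- \<Phi> u) + exp (- f \<omega> u)))) \<le> ennreal C2"
    and c: "inverse (ennreal C3) \<le> mean_evidence M N f" "mean_evidence M N f \<le> ennreal C3"
  defines "C \<equiv> (C1 / Z + C3 * max (1 / Z ^ 3) (C3 ^ 3)) * C2\<^sup>2"
  shows "1 \<le> C"
    and "ennreal (hellinger M (posterior M \<Phi>) (marginal_posterior M N f))
      \<le> ennreal C * Lp_norm M (2 * p1' * p3') (\<lambda>u. Lp_norm N p2' (\<lambda>\<omega>. ennreal \<bar>\<Phi> u - f \<omega> u\<bar>))"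
proof -
  interpret M: prob_space M by fact
  interpret N: prob_space N by fact
  note MN = M.sigma_finite_measure_axioms N.sigma_finite_measure_axioms
  have [measurable]: "(\<lambda>(u, \<omega>). f \<omega> u) \<in> borel_measurable (M \<Otimes>\<^sub>M N)"
    using measurable_pair_swap[OF f] by simp
  have f_u: "(\<lambda>\<omega>. f \<omega> u) \<in> borel_measurable N" if "u \<in> space M" for u
    using that by measurable
  define h where "h u = ennreal (exp (- \<Phi> u))" for u
  define k where "k = mean_likelihood N f"
  define s where "s u = Lp_norm N p2 (\<lambda>\<omega>. ennreal (exp (- \<Phi> u) + exp (- f \<omega> u)))" for u
  define e where "e u = Lp_norm N p2' (\<lambda>\<omega>. ennreal \<bar>\<Phi> u - f \<omega> u\<bar>)" for u
  have [measurable]: "h \<in> borel_measurable M" "k \<in> borel_measurable M"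
      "s \<in> borel_measurable M" "e \<in> borel_measurable M"
    unfolding h_def k_def mean_likelihood_def s_def e_def
    by (auto intro!: borel_measurable_Lp_norm MN)
  define D where "D = Lp_norm M (2 * p1' * p3') e"
  have p1': "1 \<le> 2 * p1'"
    using conj(1) mult_mono[of 1 2 1 p1'] by (auto simp: conjugate_exponents_def)

  \<comment> \<open>If \<open>C3 = 0\<close> then its inverse is infinite, and the bounds on the mean evidence contradict each other.\<close>
  have "C3 \<noteq> 0" using c order_trans[OF c] by auto
  then have C3: "0 < C3" using nonneg by simp
  then have c': "ennreal (1 / C3) \<le> mean_evidence M N f"
    using c(1) by (simp add: inverse_ennreal inverse_eq_divide)
  obtain Z' where Z': "mean_evidence M N f = ennreal Z'" "1 / C3 \<le> Z'" "Z' \<le> C3" "0 < Z'"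
  proof (cases "mean_evidence M N f")
    case (real r)
    then have "1 / C3 \<le> r" "r \<le> C3" using c(2) c' C3 by auto
    moreover have "0 < r" using \<open>1 / C3 \<le> r\<close> C3 by (meson divide_pos_pos less_le_trans zero_less_one)
    ultimately show ?thesis using that real by auto
  qed (use c(2) in \<open>simp add: top_unique\<close>)
  have C3_1: "1 \<le> C3"
  proof (rule ccontr)
    assume "\<not> 1 \<le> C3"
    then have "1 < 1 / C3" using C3 by simp
    then show False using Z' \<open>\<not> 1 \<le> C3\<close> by linarith
  qed
  have int_h: "(\<integral>\<^sup>+u. h u \<partial>M) = ennreal Z" using Z by (simp add: h_def evidence_def)
  have int_k: "(\<integral>\<^sup>+u. k u \<partial>M) = ennreal Z'"
    using nn_integral_mean_likelihood[OF MN f] Z' by (simp add: k_def)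

  have "evidence M \<Phi> + (\<integral>\<^sup>+u. k u \<partial>M) \<le> Lp_norm M (2 * p1' * p3) s"
    unfolding k_def s_def by (intro evidence_sum_le_Lp_norm[OF M N _ _ conj]) auto
  also have s_le: "\<dots> \<le> ennreal C2" using b unfolding s_def[abs_def] .
  finally have "Z + Z' \<le> C2"
    using Z Z' nonneg by (simp add: int_k ennreal_plus[symmetric] del: ennreal_plus)
  then have C2: "1 / C3 \<le> C2" using Z Z' by simp
  show C: "1 \<le> C"
    unfolding C_def by (rule hellinger_constant_dominates(1)[OF Z(1) nonneg(1) C3_1 C2 order_refl])

  \<comment> \<open>When the error norm is infinite, so is the right-hand side, because \<open>C > 0\<close>.\<close>
  have "ennreal (hellinger M (posterior M \<Phi>) (marginal_posterior M N f)) \<le> ennreal C * D"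
  proof (cases D)
    case top
    then show ?thesis using C by (simp add: ennreal_mult_top)
  next
    case (real d)
    let ?g = "\<lambda>u. s u * e u"
    have "Lp_norm M (2 * p1') ?g \<le> Lp_norm M (2 * p1' * p3) s * D"
      unfolding D_def by (intro Lp_norm_mult conj p1') auto
    also have "\<dots> \<le> ennreal C2 * ennreal d"
      using s_le real by (intro mult_mono) auto
    finally have g: "Lp_norm M (2 * p1') ?g \<le> ennreal (C2 * d)"
      using nonneg real by (simp add: ennreal_mult)
    have close: "h u \<le> k u + ?g u" "k u \<le> h u + ?g u" if "u \<in> space M" for u
      using exp_minus_le_Lp_norm[OF N f_u[OF that] conj(2), of "\<Phi> u"]
      by (auto simp: h_def k_def mean_likelihood_def s_def e_def)

    have "(\<integral>\<^sup>+u. ?g u \<partial>M) \<le> Lp_norm M (2 * p1') ?g"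
      by (rule nn_integral_le_Lp_norm[OF M _ conj(1)]) simp
    also note g
    finally have int_g: "(\<integral>\<^sup>+u. ?g u \<partial>M) \<le> ennreal (C2 * d)" .
    have B: "0 \<le> C2 * d" using nonneg real by simp
    have "(\<integral>\<^sup>+u. h u \<partial>M) \<le> (\<integral>\<^sup>+u. k u + ?g u \<partial>M)" by (intro nn_integral_mono close)
    also have "\<dots> \<le> ennreal Z' + ennreal (C2 * d)" using int_g by (simp add: nn_integral_add int_k)
    finally have ZZ': "ennreal Z \<le> ennreal Z' + ennreal (C2 * d)" by (simp add: int_h)
    have "(\<integral>\<^sup>+u. k u \<partial>M) \<le> (\<integral>\<^sup>+u. h u + ?g u \<partial>M)" by (intro nn_integral_mono close)
    also have "\<dots> \<le> ennreal Z + ennreal (C2 * d)" using int_g by (simp add: nn_integral_add int_h)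
    finally have "ennreal Z' \<le> ennreal Z + ennreal (C2 * d)" by (simp add: int_k)
    with ZZ' have "\<bar>Z - Z'\<bar> \<le> C2 * d"
      using Z Z' B by (intro ennreal_abs_diff_le) auto
    then have ZZ'_sq: "(Z - Z')\<^sup>2 \<le> (C2 * d)\<^sup>2" using B by (simp add: abs_le_square_iff[symmetric])

    have k_pos: "0 < k u" if "u \<in> space M" for u
    proof -
      have "k u \<noteq> 0"
        using f_u[OF that] N.AE_False unfolding k_def mean_likelihood_def
        by (subst nn_integral_0_iff_AE) (auto simp: ennreal_eq_0_iff)
      then show ?thesis by (simp add: zero_less_iff_neq_zero)
    qed
    have "inverse (h u) = ennreal (exp (\<Phi> u))" for u
      by (simp add: h_def inverse_ennreal exp_minus)
    then have a': "min (Lp_norm M p1 (\<lambda>u. inverse (k u))) (Lp_norm M p1 (\<lambda>u. inverse (h u))) \<le> ennreal C1"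
      using a by (simp add: k_def)
    have k_fin: "AE u in M. k u < \<infinity>"
      using nn_integral_PInf_AE[of k M] int_k by (auto simp: less_top)
    have "(\<integral>\<^sup>+u. ennreal ((sqrt (enn2real (h u)) - sqrt (enn2real (k u)))\<^sup>2) \<partial>M)
        \<le> min (Lp_norm M p1 (\<lambda>u. inverse (k u))) (Lp_norm M p1 (\<lambda>u. inverse (h u)))
          * (Lp_norm M (2 * p1') ?g * Lp_norm M (2 * p1') ?g)"
      by (intro nn_integral_sqrt_diff_square_le conj(1) k_pos close k_fin) (auto simp: h_def)
    also have "\<dots> \<le> ennreal C1 * (ennreal (C2 * d) * ennreal (C2 * d))"
      by (intro mult_mono a' g) auto
    also have "\<dots> = ennreal (C1 * (C2 * d)\<^sup>2)"
      using B nonneg by (simp add: ennreal_mult power2_eq_square)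
    finally have "hellinger M (density M (\<lambda>u. h u / ennreal Z)) (density M (\<lambda>u. k u / ennreal Z'))
        \<le> sqrt (C1 * (C2 * d)\<^sup>2 / Z + (Z - Z')\<^sup>2 / Z\<^sup>2)"
      using nonneg Z Z' by (intro hellinger_density_le MN int_h int_k) auto
    also have "\<dots> \<le> sqrt (C1 * (C2 * d)\<^sup>2 / Z + (C2 * d)\<^sup>2 / Z\<^sup>2)"
      using ZZ'_sq by (intro real_sqrt_le_mono add_left_mono divide_right_mono) auto
    also have "\<dots> \<le> C * d"
      unfolding C_def by (rule hellinger_constant_dominates(2)[OF Z(1) nonneg(1) C3_1 C2 real(1)])
    finally show ?thesis
      using C real Z Z'
      by (auto simp: posterior_def marginal_posterior_def h_def k_def ennreal_mult[symmetric] intro!: ennreal_leI)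
  qed
  then show "ennreal (hellinger M (posterior M \<Phi>) (marginal_posterior M N f))
      \<le> ennreal C * Lp_norm M (2 * p1' * p3') (\<lambda>u. Lp_norm N p2' (\<lambda>\<omega>. ennreal \<bar>\<Phi> u - f \<omega> u\<bar>))"
    by (simp add: D_def e_def[abs_def])
qed

theorem theorem3p1:
  fixes \<mu>0 :: "'u :: {banach, second_countable_topology} measure"
    and W :: "'w measure"
    and \<nu> :: "nat \<Rightarrow> 'w measure"
    and \<Phi> :: "'u \<Rightarrow> real"
    and \<Phi>N :: "nat \<Rightarrow> 'w \<Rightarrow> 'u \<Rightarrow> real"
    and Z C1 C2 C3 :: real
    and p1 p1' p2 p2' p3 p3' :: ennreal
  assumes prior: "prob_space \<mu>0" "sets \<mu>0 = sets borel"
    and \<Phi>_measurable: "\<Phi> \<in> borel_measurable borel"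
    and Z: "0 < Z" "evidence \<mu>0 \<Phi> = ennreal Z"
    and \<nu>: "\<And>N. prob_space (\<nu> N)" "\<And>N. sets (\<nu> N) = sets W"
    and \<Phi>N_measurable: "\<And>N. (\<lambda>(\<omega>, u). \<Phi>N N \<omega> u) \<in> borel_measurable (W \<Otimes>\<^sub>M borel)"
    and exponents: "conjugate_exponents p1 p1'" "conjugate_exponents p2 p2'" "conjugate_exponents p3 p3'"
    and nonneg: "0 \<le> C1" "0 \<le> C2" "0 \<le> C3"
    and a: "\<And>N. min (Lp_norm \<mu>0 p1 (\<lambda>u. inverse (mean_likelihood (\<nu> N) (\<Phi>N N) u)))
                     (Lp_norm \<mu>0 p1 (\<lambda>u. ennreal (exp (\<Phi> u)))) \<le> ennreal C1"
    and b: "\<And>N. Lp_norm \<mu>0 (2 * p1' * p3)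
                   (\<lambda>u. Lp_norm (\<nu> N) p2 (\<lambda>\<omega>. ennreal (exp (- \<Phi> u) + exp (- \<Phi>N N \<omega> u)))) \<le> ennreal C2"
    and c: "\<And>N. inverse (ennreal C3) \<le> mean_evidence \<mu>0 (\<nu> N) (\<Phi>N N)"
           "\<And>N. mean_evidence \<mu>0 (\<nu> N) (\<Phi>N N) \<le> ennreal C3"
  shows "\<exists>C>0. C = (C1 / Z + C3 * max (1 / Z ^ 3) (C3 ^ 3)) * C2 ^ 2 \<and>
           (\<forall>N. ennreal (hellinger \<mu>0 (posterior \<mu>0 \<Phi>) (marginal_posterior \<mu>0 (\<nu> N) (\<Phi>N N)))
                \<le> ennreal C * Lp_norm \<mu>0 (2 * p1' * p3')
                    (\<lambda>u. Lp_norm (\<nu> N) p2' (\<lambda>\<omega>. ennreal \<bar>\<Phi> u - \<Phi>N N \<omega> u\<bar>)))"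
proof -
  let ?C = "(C1 / Z + C3 * max (1 / Z ^ 3) (C3 ^ 3)) * C2 ^ 2"
  have \<Phi>: "\<Phi> \<in> borel_measurable \<mu>0"
    using \<Phi>_measurable by (simp cong: measurable_cong_sets add: prior(2))
  have f: "(\<lambda>(\<omega>, u). \<Phi>N N \<omega> u) \<in> borel_measurable (\<nu> N \<Otimes>\<^sub>M \<mu>0)" for N
    using \<Phi>N_measurable[of N]
    by (subst measurable_cong_sets[OF sets_pair_measure_cong[OF \<nu>(2) prior(2)] refl])
  note * = hellinger_marginal_posterior_le[OF prior(1) \<nu>(1) \<Phi> f Z exponents nonneg a b c]
  show ?thesis
    using * by (intro exI[of _ ?C]) auto
qed

end
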